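(* If $u:\Omega\subseteq\mathbb{R}^2\to\mathbb{R}^3$ is in $C^2(\Omega)^3$, conformal and $\infty$-Harmonic, then $u(\Omega)$ is contained in an affine plane of $\mathbb{R}^3$.
   Context: Here $\Omega$ is an open subset of $\mathbb{R}^2$. $Du(x)\in\mathbb{R}^{3\times2}$ is the gradient matrix with entries $D_iu_\alpha$, $|Du|$ is its Euclidean (Frobenius) norm, and $[Du(x)]^\bot$ is the orthogonal projection of $\mathbb{R}^3$ onto the nullspace of $Du(x)^\top$. The map $u$ is conformal if there is $f\in C^1(\Omega)$ such that $Du^\top Du=f^2I$ on $\Omega$. The map $u$ is $\infty$-Harmonic if it solves $\Delta_\infty u=0$ on $\Omega$, where in components (summing over repeated indices) $$(\Delta_\infty u)_\alpha=D_iu_\alpha\,D_ju_\beta\,D^2_{ij}u_\beta+|Du|^2[Du]^\bot_{\alpha\beta}D^2_{ii}u_\beta,\qquad\alpha=1,2,3.$$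
   Formalization: The claim fails for disconnected Ω (u=(x,y,0) on one disc, (x,0,y) on a disjoint one), so u(Ω) is shown to lie in one affine plane when Ω is connected; for arbitrary open Ω, the image of each connected component lies in an affine plane. *)

theory Defs
  imports "HOL-Analysis.Analysis"
begin

definition partial_deriv :: "'n::finite \<Rightarrow> (real^'n \<Rightarrow> 'b::real_normed_vector) \<Rightarrow> real^'n \<Rightarrow> 'b"
  where "partial_deriv i f x = frechet_derivative f (at x) (axis i 1)"

(* The class C^k(S) for open S.  Only the values on S matter, because every derivative
   is taken at a point of the open set S. *)
primrec Ck_on :: "nat \<Rightarrow> (real^'n::finite \<Rightarrow> 'b::real_normed_vector) \<Rightarrow> (real^'n) set \<Rightarrow> bool"
  where
    "Ck_on 0 f S \<longleftrightarrow> continuous_on S f"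
  | "Ck_on (Suc k) f S \<longleftrightarrow>
       (\<forall>x\<in>S. f differentiable (at x)) \<and> (\<forall>i. Ck_on k (partial_deriv i f) S)"

(* Row alpha, column i is D_i u_alpha.  The library norm on matrices is the Frobenius norm. *)
definition grad :: "(real^'n::finite \<Rightarrow> real^'m::finite) \<Rightarrow> real^'n \<Rightarrow> real^'n^'m"
  where "grad u x = jacobian u (at x)"

definition hess :: "(real^'n::finite \<Rightarrow> real^'m::finite) \<Rightarrow> real^'n \<Rightarrow> 'n \<Rightarrow> 'n \<Rightarrow> 'm \<Rightarrow> real"
  where "hess u x i j \<beta> = partial_deriv i (partial_deriv j (\<lambda>y. u y $ \<beta>)) x"

definition orth_proj :: "'a::euclidean_space set \<Rightarrow> 'a \<Rightarrow> 'a"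
  where "orth_proj S x = (THE y. y \<in> S \<and> x - y \<in> orthogonal_comp S)"

lemma orth_proj_unique:
  fixes S :: "'a::euclidean_space set"
  assumes "subspace S"
  shows "\<exists>!y. y \<in> S \<and> x - y \<in> orthogonal_comp S"
proof -
  obtain y z where "y \<in> span S" and "\<And>w. w \<in> span S \<Longrightarrow> orthogonal z w" and "x = y + z"
    using orthogonal_subspace_decomp_exists[of S x] by blast
  then have y: "y \<in> S" "x - y \<in> orthogonal_comp S"
    using assms by (simp_all add: orthogonal_comp_def orthogonal_commute span_eq_iff[THEN iffD2])
  have "y' = y" if "y' \<in> S" "x - y' \<in> orthogonal_comp S" for y'
  proof -
    have "y' - y \<in> S"
      using assms that(1) y(1) by (rule subspace_diff)
    moreover have "y' - y \<in> orthogonal_comp S"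
      using subspace_diff[OF subspace_orthogonal_comp y(2) that(2)] by simp
    ultimately show ?thesis
      by (auto simp: orthogonal_comp_def orthogonal_self)
  qed
  with y show ?thesis by blast
qed

definition perp :: "real^'n::finite^'m::finite \<Rightarrow> real^'m^'m"
  where "perp A = matrix (orth_proj {w. transpose A *v w = 0})"

definition inf_laplacian :: "(real^'n::finite \<Rightarrow> real^'m::finite) \<Rightarrow> real^'n \<Rightarrow> real^'m"
  where "inf_laplacian u x = (\<chi> \<alpha>.
     (\<Sum>i\<in>UNIV. \<Sum>j\<in>UNIV. \<Sum>\<beta>\<in>UNIV.
        grad u x $ \<alpha> $ i * grad u x $ \<beta> $ j * hess u x i j \<beta>)
     + (norm (grad u x))\<^sup>2 *
       (\<Sum>i\<in>UNIV. \<Sum>\<beta>\<in>UNIV. perp (grad u x) $ \<alpha> $ \<beta> * hess u x i i \<beta>))"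

definition conformal_on :: "(real^'n::finite) set \<Rightarrow> (real^'n \<Rightarrow> real^'m::finite) \<Rightarrow> bool"
  where "conformal_on \<Omega> u \<longleftrightarrow>
    (\<exists>f. Ck_on 1 f \<Omega> \<and>
         (\<forall>x\<in>\<Omega>. transpose (grad u x) ** grad u x = (f x)\<^sup>2 *\<^sub>R mat 1))"

definition inf_harmonic_on :: "(real^'n::finite) set \<Rightarrow> (real^'n \<Rightarrow> real^'m::finite) \<Rightarrow> bool"
  where "inf_harmonic_on \<Omega> u \<longleftrightarrow> (\<forall>x\<in>\<Omega>. inf_laplacian u x = 0)"

definition affine_plane :: "'a::euclidean_space set \<Rightarrow> bool"
  where "affine_plane P \<longleftrightarrow> affine P \<and> aff_dim P = 2"

end

theory Submission
  imports Defs "HOL-Complex_Analysis.Conformal_Mappings"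
begin

text \<open>
  Write \<open>a i\<close> for the partial derivative \<open>D_i u\<close>. Conformality says that the vectors \<open>a i\<close> are
  orthogonal and of the same length \<open>\<bar>f\<bar>\<close>. The infinity-Laplacian is the sum of a tangential part,
  a combination of the \<open>a i\<close> whose coefficients are half the partial derivatives of \<open>|Du|^2\<close>,
  and a normal part, \<open>|Du|^2\<close> times the projection of the ordinary Laplacian of \<open>u\<close> onto the
  orthogonal complement of the \<open>a i\<close>. The two parts vanish separately.

  The tangential part makes \<open>|Du|^2\<close> locally constant (\<open>conformal_factor_constant\<close>): where
  \<open>Du\<close> is nonzero the \<open>a i\<close> are independent, and where \<open>Du\<close> is zero so is the derivative of
  \<open>|Du|^2\<close>. On a connected set the conformal factor is therefore one constant, and \<open>u\<close> is either
  constant or a dilated isometric immersion. Differentiating the constants \<open>a i \<bullet> a j\<close>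
  shows that the Laplacian of \<open>u\<close> is orthogonal to every \<open>a k\<close>; the normal part kills what
  remains, so \<open>u\<close> is harmonic (\<open>conformal_inf_harmonic_imp_harmonic\<close>).

  In two dimensions, harmonicity and the symmetry of second derivatives are the Cauchy-Riemann
  equations for \<open>\<phi> = a 1 - \<i> a 2\<close>, and \<open>|\<phi>|^2 = |Du|^2\<close> is constant. A holomorphic vector
  function of constant length is constant, by the maximum modulus principle
  (\<open>holomorphic_constant_norm_imp_constant\<close>). This takes the place of the Gauss equation for
  flat minimal surfaces, and it requires no third derivatives of \<open>u\<close>. Hence \<open>Du\<close> is constant,
  and a vector \<open>n\<close> orthogonal to both partial derivatives gives a plane
  \<open>n \<bullet> y = const\<close> that contains the image.
\<close>

section \<open>Symmetry of second derivatives\<close>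

text \<open>
  The second difference of \<open>F\<close> over a small parallelogram is symmetric in \<open>v\<close> and \<open>w\<close>, whereas
  two applications of the mean value theorem, first along \<open>v\<close> and then along \<open>w\<close>, express it by
  one of the two mixed derivatives. Comparing the two orders gives Schwarz's theorem below.
\<close>

lemma second_difference_mvt:
  fixes F :: "'a::real_normed_vector \<Rightarrow> real"
  assumes F: "\<And>y. y \<in> ball x e \<Longrightarrow> (F has_derivative F' y) (at y)"
    and G: "\<And>y. y \<in> ball x e \<Longrightarrow> ((\<lambda>y. F' y v) has_derivative G y) (at y)"
    and t: "0 < t" "t * (norm v + norm w) < e"
  shows "\<exists>\<xi>. dist x \<xi> \<le> t * (norm v + norm w) \<and>
    F (x + t *\<^sub>R v + t *\<^sub>R w) - F (x + t *\<^sub>R v) - F (x + t *\<^sub>R w) + F x = t\<^sup>2 * G \<xi> w"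
proof -
  have near: "dist x (x + s *\<^sub>R v + r *\<^sub>R w) \<le> t * (norm v + norm w)"
    if "0 \<le> s" "s \<le> t" "0 \<le> r" "r \<le> t" for s r
  proof -
    have "dist x (x + s *\<^sub>R v + r *\<^sub>R w) = norm (s *\<^sub>R v + r *\<^sub>R w)"
      by (metis add.assoc add_diff_cancel_left' dist_commute dist_norm)
    also have "\<dots> \<le> s * norm v + r * norm w"
      using that norm_triangle_ineq[of "s *\<^sub>R v" "r *\<^sub>R w"] by simp
    also have "\<dots> \<le> t * norm v + t * norm w"
      using that by (intro add_mono mult_right_mono) auto
    finally show ?thesis by (simp add: algebra_simps)
  qed
  have inb: "x + s *\<^sub>R v + r *\<^sub>R w \<in> ball x e" if "0 \<le> s" "s \<le> t" "0 \<le> r" "r \<le> t" for s r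
    using near[OF that] t by simp
  have line: "((\<lambda>s. K (p + s *\<^sub>R d)) has_real_derivative K' d) (at s)"
    if K: "(K has_derivative K') (at (p + s *\<^sub>R d))"
    for K :: "'a \<Rightarrow> real" and K' p d s
  proof -
    have "((\<lambda>s. p + s *\<^sub>R d) has_derivative (\<lambda>h. h *\<^sub>R d)) (at s)"
      by (auto intro!: derivative_eq_intros)
    from has_derivative_compose[OF this K]
    show ?thesis
      using has_derivative_linear[OF K] by (simp add: has_field_derivative_def linear_cmul mult_commute_abs)
  qed
  \<comment> \<open>the increment of \<open>F\<close> along the side \<open>t w\<close>, as the base point moves along \<open>v\<close>\<close>
  define g where "g s = F (x + s *\<^sub>R v + t *\<^sub>R w) - F (x + s *\<^sub>R v)" for s
  have "(g has_real_derivative F' (x + s *\<^sub>R v + t *\<^sub>R w) v - F' (x + s *\<^sub>R v) v) (at s)"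
    if "0 \<le> s" "s \<le> t" for s
  proof -
    have "((\<lambda>s. F ((x + t *\<^sub>R w) + s *\<^sub>R v)) has_real_derivative F' ((x + t *\<^sub>R w) + s *\<^sub>R v) v) (at s)"
      using inb[of s t] that t by (intro line F) (simp add: algebra_simps)
    moreover have "((\<lambda>s. F (x + s *\<^sub>R v)) has_real_derivative F' (x + s *\<^sub>R v) v) (at s)"
      using inb[of s 0] that t by (intro line F) simp
    ultimately show ?thesis
      unfolding g_def using DERIV_diff by (force simp: add_ac)
  qed
  from MVT2[of 0 t g, OF t(1) this] obtain s where s: "0 < s" "s < t"
    and gs: "g t - g 0 = t * (F' (x + s *\<^sub>R v + t *\<^sub>R w) v - F' (x + s *\<^sub>R v) v)"
    by auto
  have "((\<lambda>r. F' (x + s *\<^sub>R v + r *\<^sub>R w) v) has_real_derivative G (x + s *\<^sub>R v + r *\<^sub>R w) w) (at r)"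
    if "0 \<le> r" "r \<le> t" for r
    using inb[of s r] that s by (intro line[of "\<lambda>y. F' y v"] G) simp
  from MVT2[OF t(1) this] obtain r where r: "0 < r" "r < t"
    and kr: "F' (x + s *\<^sub>R v + t *\<^sub>R w) v - F' (x + s *\<^sub>R v + 0 *\<^sub>R w) v
       = (t - 0) * G (x + s *\<^sub>R v + r *\<^sub>R w) w"
    by blast
  have "F (x + t *\<^sub>R v + t *\<^sub>R w) - F (x + t *\<^sub>R v) - F (x + t *\<^sub>R w) + F x = g t - g 0"
    by (simp add: g_def)
  also have "\<dots> = t\<^sup>2 * G (x + s *\<^sub>R v + r *\<^sub>R w) w"
    using gs kr by (simp add: power2_eq_square)
  finally show ?thesis
    using near[of s r] s r by auto
qed

lemma second_derivative_symmetric: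
  fixes F :: "'a::real_normed_vector \<Rightarrow> real"
  assumes "open S" "x \<in> S"
    and F: "\<And>y. y \<in> S \<Longrightarrow> (F has_derivative F' y) (at y)"
    and G: "\<And>y. y \<in> S \<Longrightarrow> ((\<lambda>y. F' y v) has_derivative G y) (at y)"
    and H: "\<And>y. y \<in> S \<Longrightarrow> ((\<lambda>y. F' y w) has_derivative H y) (at y)"
    and contG: "continuous_on S (\<lambda>y. G y w)" and contH: "continuous_on S (\<lambda>y. H y v)"
  shows "G x w = H x v"
proof (rule ccontr)
  assume ne: "G x w \<noteq> H x v"
  define d where "d = \<bar>G x w - H x v\<bar> / 2"
  have "d > 0" using ne by (simp add: d_def)
  have "isCont (\<lambda>y. G y w) x" "isCont (\<lambda>y. H y v) x"
    using contG contH assms(1,2) by (auto simp: continuous_on_eq_continuous_at)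
  then obtain e1 e2 where e1: "e1 > 0" "\<And>y. dist y x < e1 \<Longrightarrow> dist (G y w) (G x w) < d"
    and e2: "e2 > 0" "\<And>y. dist y x < e2 \<Longrightarrow> dist (H y v) (H x v) < d"
    using \<open>d > 0\<close> unfolding continuous_at_eps_delta by metis
  obtain e3 where e3: "e3 > 0" "ball x e3 \<subseteq> S"
    using assms(1,2) open_contains_ball by blast
  define e where "e = min e1 (min e2 e3)"
  have "e > 0" using e1 e2 e3 by (simp add: e_def)
  \<comment> \<open>the summand 1 makes the parallelogram fit into the ball even if \<open>v = w = 0\<close>\<close>
  define t where "t = e / (norm v + norm w + 1)"
  have pos: "norm v + norm w + 1 > 0" by (smt (verit) norm_ge_zero)
  have t: "t > 0" "t * (norm v + norm w) < e"
    using \<open>e > 0\<close> pos by (auto simp: t_def field_simps)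
  have sub: "y \<in> S" if "y \<in> ball x e" for y
    using that e3 by (auto simp: e_def)
  obtain \<xi> where \<xi>: "dist x \<xi> \<le> t * (norm v + norm w)"
    "F (x + t *\<^sub>R v + t *\<^sub>R w) - F (x + t *\<^sub>R v) - F (x + t *\<^sub>R w) + F x = t\<^sup>2 * G \<xi> w"
    using second_difference_mvt[of x e F F' v G t w] F G sub t by blast
  obtain \<eta> where \<eta>: "dist x \<eta> \<le> t * (norm w + norm v)"
    "F (x + t *\<^sub>R w + t *\<^sub>R v) - F (x + t *\<^sub>R w) - F (x + t *\<^sub>R v) + F x = t\<^sup>2 * H \<eta> v"
    using second_difference_mvt[of x e F F' w H t v] F H sub t by (metis add.commute)
  have "x + t *\<^sub>R w + t *\<^sub>R v = x + t *\<^sub>R v + t *\<^sub>R w" by (simp only: add_ac)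
  have "t\<^sup>2 * G \<xi> w = t\<^sup>2 * H \<eta> v"
    using \<xi>(2) \<eta>(2) unfolding \<open>x + t *\<^sub>R w + t *\<^sub>R v = x + t *\<^sub>R v + t *\<^sub>R w\<close> by linarith
  then have "G \<xi> w = H \<eta> v" using t by simp
  moreover have "dist (G \<xi> w) (G x w) < d"
    using \<xi>(1) t by (intro e1) (simp add: e_def dist_commute)
  moreover have "dist (H \<eta> v) (H x v) < d"
    using \<eta>(1) t by (intro e2) (simp add: e_def dist_commute add.commute)
  ultimately show False
    unfolding d_def dist_real_def by (simp add: abs_if field_simps split: if_splits)
qed

section \<open>Partial derivatives\<close>

lemma has_derivative_partial_deriv:
  fixes f :: "real^'n::finite \<Rightarrow> 'b::real_normed_vector"
  assumes "f differentiable (at x)"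
  shows "(f has_derivative (\<lambda>h. \<Sum>i\<in>UNIV. h $ i *\<^sub>R partial_deriv i f x)) (at x)"
proof -
  have D: "(f has_derivative frechet_derivative f (at x)) (at x)"
    using assms frechet_derivative_works by blast
  have "frechet_derivative f (at x) h = (\<Sum>i\<in>UNIV. h $ i *\<^sub>R partial_deriv i f x)" for h
  proof -
    have "h = (\<Sum>i\<in>UNIV. h $ i *\<^sub>R axis i 1)"
      using basis_expansion[of h] by (simp add: scalar_mult_eq_scaleR)
    then have "frechet_derivative f (at x) h
        = frechet_derivative f (at x) (\<Sum>i\<in>UNIV. h $ i *\<^sub>R axis i 1)"
      by (rule arg_cong)
    then show ?thesis
      using has_derivative_linear[OF D] by (simp add: linear_sum linear_cmul partial_deriv_def)
  qed
  then have "frechet_derivative f (at x) = (\<lambda>h. \<Sum>i\<in>UNIV. h $ i *\<^sub>R partial_deriv i f x)"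
    by (rule ext)
  with D show ?thesis by (rule back_subst)
qed

lemma sum_axis_scaleR:
  fixes g :: "'n::finite \<Rightarrow> 'b::real_normed_vector"
  shows "(\<Sum>i\<in>UNIV. (axis k 1 :: real^'n) $ i *\<^sub>R g i) = g k"
proof -
  have "(\<Sum>i\<in>UNIV. (axis k 1 :: real^'n) $ i *\<^sub>R g i) = (\<Sum>i\<in>UNIV. if i = k then g i else 0)"
    by (intro sum.cong) (auto simp: axis_def)
  then show ?thesis by simp
qed

lemma has_derivative_component_partials:
  fixes f :: "real^'n::finite \<Rightarrow> real^'m::finite"
  assumes "f differentiable (at x)"
  shows "((\<lambda>y. f y $ \<beta>) has_derivative (\<lambda>h. (\<Sum>i\<in>UNIV. h $ i *\<^sub>R partial_deriv i f x) $ \<beta>)) (at x)"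
  using bounded_linear.has_derivative[OF bounded_linear_vec_nth has_derivative_partial_deriv[OF assms]] .

lemma partial_deriv_eqI:
  fixes f :: "real^'n::finite \<Rightarrow> 'b::real_normed_vector"
  assumes "(f has_derivative f') (at x)"
  shows "partial_deriv i f x = f' (axis i 1)"
  using frechet_derivative_at[OF assms] by (simp add: partial_deriv_def)

lemma Ck_on_2D:
  assumes "Ck_on 2 f S" "x \<in> S"
  shows "f differentiable (at x)" "partial_deriv j f differentiable (at x)"
    "continuous_on S (partial_deriv i (partial_deriv j f))"
  using assms by (auto simp: numeral_2_eq_2)

lemma mixed_partials_commute:
  fixes f :: "real^'n::finite \<Rightarrow> real^'m::finite"
  assumes "open S" "Ck_on 2 f S" "x \<in> S"
  shows "partial_deriv i (partial_deriv j f) x = partial_deriv j (partial_deriv i f) x"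
proof -
  note D = has_derivative_component_partials
  \<comment> \<open>the \<open>\<beta>\<close>-th component of the derivative of \<open>g\<close> at \<open>y\<close> in direction \<open>h\<close>\<close>
  define L where "L g y h \<beta> = (\<Sum>k\<in>UNIV. h $ k *\<^sub>R partial_deriv k g y) $ \<beta>"
    for g :: "real^'n \<Rightarrow> real^'m" and y h \<beta>
  have L: "L g y (axis k 1) \<beta> = partial_deriv k g y $ \<beta>" for g y k \<beta>
    by (simp only: L_def sum_axis_scaleR)
  have "partial_deriv i (partial_deriv j f) x $ \<beta> = partial_deriv j (partial_deriv i f) x $ \<beta>" for \<beta>
  proof -
    have "L (partial_deriv j f) x (axis i 1) \<beta> = L (partial_deriv i f) x (axis j 1) \<beta>"
    proof (rule second_derivative_symmetric[OF assms(1,3),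
          of "\<lambda>y. f y $ \<beta>" "\<lambda>y h. L f y h \<beta>" "axis j 1" "\<lambda>y h. L (partial_deriv j f) y h \<beta>"
             "axis i 1" "\<lambda>y h. L (partial_deriv i f) y h \<beta>"])
      fix y assume "y \<in> S"
      note D2 = Ck_on_2D[OF assms(2) this]
      show "((\<lambda>y. f y $ \<beta>) has_derivative (\<lambda>h. L f y h \<beta>)) (at y)"
        unfolding L_def by (rule D[OF D2(1)])
      show "((\<lambda>y. L f y (axis j 1) \<beta>) has_derivative (\<lambda>h. L (partial_deriv j f) y h \<beta>)) (at y)"
        unfolding L unfolding L_def by (rule D[OF D2(2)])
      show "((\<lambda>y. L f y (axis i 1) \<beta>) has_derivative (\<lambda>h. L (partial_deriv i f) y h \<beta>)) (at y)"
        unfolding L unfolding L_def by (rule D[OF D2(2)])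
    next
      note C = continuous_on_component[OF Ck_on_2D(3)[OF assms(2,3)]]
      show "continuous_on S (\<lambda>y. L (partial_deriv j f) y (axis i 1) \<beta>)"
        unfolding L by (rule C)
      show "continuous_on S (\<lambda>y. L (partial_deriv i f) y (axis j 1) \<beta>)"
        unfolding L by (rule C)
    qed
    then show ?thesis by (simp only: L)
  qed
  then show ?thesis by (simp add: vec_eq_iff)
qed

section \<open>The operator in vector form\<close>

lemma orth_proj_spec:
  fixes S :: "'a::euclidean_space set"
  assumes "subspace S"
  shows "orth_proj S x \<in> S" "x - orth_proj S x \<in> orthogonal_comp S"
  using theI'[OF orth_proj_unique[OF assms, of x]] by (auto simp: orth_proj_def)

lemma orth_proj_eqI:
  fixes S :: "'a::euclidean_space set"
  assumes "subspace S" "y \<in> S" "x - y \<in> orthogonal_comp S"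
  shows "orth_proj S x = y"
  using orth_proj_unique[OF assms(1), of x] orth_proj_spec[OF assms(1), of x] assms(2,3) by blast

lemma linear_orth_proj:
  fixes S :: "'a::euclidean_space set"
  assumes S: "subspace S"
  shows "linear (orth_proj S)"
proof (rule linearI)
  note C = subspace_orthogonal_comp[of S]
  show "orth_proj S (x + y) = orth_proj S x + orth_proj S y" for x y
    using subspace_add[OF C orth_proj_spec(2)[OF S, of x] orth_proj_spec(2)[OF S, of y]]
    by (intro orth_proj_eqI[OF S] subspace_add[OF S] orth_proj_spec[OF S]) (simp add: algebra_simps)
  show "orth_proj S (c *\<^sub>R x) = c *\<^sub>R orth_proj S x" for c x
    using subspace_scale[OF C orth_proj_spec(2)[OF S, of x], of c]
    by (intro orth_proj_eqI[OF S] subspace_scale[OF S] orth_proj_spec[OF S]) (simp add: algebra_simps)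
qed

text \<open>
  The matrix \<open>perp A\<close> acts as the projection it is built from because orthogonal projection onto
  a subspace is linear.
\<close>

lemma perp_mult_vec:
  fixes A :: "real^'n::finite^'m::finite"
  shows "transpose A *v (perp A *v w) = 0"
    and "transpose A *v w = 0 \<Longrightarrow> perp A *v w = w"
proof -
  have S: "subspace {w. transpose A *v w = 0}"
    by (intro subspaceI)
      (auto simp: matrix_vector_right_distrib matrix_vector_mult_scaleR simp del: transpose_matrix_vector)
  have *: "perp A *v w = orth_proj {w. transpose A *v w = 0} w"
    unfolding perp_def by (rule matrix_works)
      (simp only: linear_matrix_vector_mul_eq linear_orth_proj[OF S])
  show "transpose A *v (perp A *v w) = 0"
    using orth_proj_spec(1)[OF S, of w] by (simp add: *)
  show "perp A *v w = w" if "transpose A *v w = 0"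
    unfolding * using that by (intro orth_proj_eqI[OF S]) (auto simp: orthogonal_comp_def orthogonal_def)
qed

lemma grad_nth:
  "grad u x $ \<alpha> $ i = partial_deriv i u x $ \<alpha>"
  by (simp add: grad_def jacobian_def matrix_def partial_deriv_def)

lemma transpose_grad_mult:
  "(transpose (grad u x) *v w) $ i = partial_deriv i u x \<bullet> w"
  by (simp add: grad_def jacobian_def matrix_def partial_deriv_def
      matrix_vector_mult_def transpose_def inner_vec_def)

lemma norm_grad:
  fixes u :: "real^'n::finite \<Rightarrow> real^'m::finite"
  shows "(norm (grad u x))\<^sup>2 = (\<Sum>i\<in>UNIV. partial_deriv i u x \<bullet> partial_deriv i u x)"
proof -
  have "(norm (grad u x))\<^sup>2 = (\<Sum>\<alpha>\<in>UNIV. \<Sum>i\<in>UNIV. partial_deriv i u x $ \<alpha> * partial_deriv i u x $ \<alpha>)"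
    by (simp add: power2_norm_eq_inner inner_vec_def grad_nth)
  also have "\<dots> = (\<Sum>i\<in>UNIV. partial_deriv i u x \<bullet> partial_deriv i u x)"
    by (subst sum.swap) (simp add: inner_vec_def)
  finally show ?thesis .
qed

text \<open>
  \<open>hess\<close> differentiates the components of \<open>u\<close>, whereas the regularity assumption concerns the
  partial derivatives of \<open>u\<close> as a vector function; on an open set the two can be exchanged.
\<close>

lemma hess_eq:
  assumes "open S" "Ck_on 2 u S" "x \<in> S"
  shows "hess u x i j \<beta> = partial_deriv i (partial_deriv j u) x $ \<beta>"
proof -
  have "partial_deriv j (\<lambda>y. u y $ \<beta>) y = partial_deriv j u y $ \<beta>" if "y \<in> S" for y
    using partial_deriv_eqI[OF has_derivative_component_partials[OF Ck_on_2D(1)[OF assms(2) that]]]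
    by (simp only: sum_axis_scaleR)
  then have "(partial_deriv j (\<lambda>y. u y $ \<beta>) has_derivative
      (\<lambda>h. (\<Sum>i\<in>UNIV. h $ i *\<^sub>R partial_deriv i (partial_deriv j u) x) $ \<beta>)) (at x)"
    using has_derivative_component_partials[OF Ck_on_2D(2)[OF assms(2,3)]]
    by (rule_tac has_derivative_transform_within_open[OF _ assms(1,3)]) auto
  from partial_deriv_eqI[OF this, of i] show ?thesis
    by (simp only: hess_def sum_axis_scaleR)
qed

text \<open>
  The first sum is tangential, i.e. in the span of the partial derivatives of \<open>u\<close>; the second term
  is normal.
\<close>

lemma inf_laplacian_vector_form:
  fixes u :: "real^'n::finite \<Rightarrow> real^'m::finite"
  assumes "open S" "Ck_on 2 u S" "x \<in> S"
  shows "inf_laplacian u x =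
    (\<Sum>i\<in>UNIV. (\<Sum>j\<in>UNIV. partial_deriv j u x \<bullet> partial_deriv i (partial_deriv j u) x) *\<^sub>R partial_deriv i u x)
    + (norm (grad u x))\<^sup>2 *\<^sub>R (perp (grad u x) *v (\<Sum>i\<in>UNIV. partial_deriv i (partial_deriv i u) x))"
    (is "_ = ?T + _ *\<^sub>R (_ *v ?L)")
proof -
  have normal: "(\<Sum>i\<in>UNIV. \<Sum>\<beta>\<in>UNIV. perp (grad u x) $ \<alpha> $ \<beta> * hess u x i i \<beta>)
      = (perp (grad u x) *v ?L) $ \<alpha>" for \<alpha>
    by (subst sum.swap) (simp add: hess_eq[OF assms] matrix_vector_mult_def sum_distrib_left)
  have tangential: "(\<Sum>i\<in>UNIV. \<Sum>j\<in>UNIV. \<Sum>\<beta>\<in>UNIV.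
      grad u x $ \<alpha> $ i * grad u x $ \<beta> $ j * hess u x i j \<beta>) = ?T $ \<alpha>" for \<alpha>
    by (simp add: hess_eq[OF assms] grad_nth inner_vec_def sum_distrib_left sum_distrib_right mult.commute mult.left_commute)
  show ?thesis
    by (simp add: vec_eq_iff inf_laplacian_def normal tangential)
qed


section \<open>Conformal infinity-harmonic maps\<close>

text \<open>
  Pairing the equation with \<open>D_k u\<close> removes the normal part, and by orthogonality of the partial
  derivatives only the \<open>k\<close>-th tangential coefficient survives, multiplied by \<open>r\<close>. If \<open>r = 0\<close>, then
  all \<open>D_j u\<close> vanish, and the coefficients, being sums of products with the \<open>D_j u\<close>, vanish too.
  Thus the whole tangential part is zero even at critical points of \<open>u\<close>.
\<close>

lemma conformal_inf_harmonic_pointwise: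
  fixes u :: "real^'n::finite \<Rightarrow> real^'m::finite"
  assumes S: "open S" "Ck_on 2 u S" "x \<in> S"
    and conf: "transpose (grad u x) ** grad u x = r *\<^sub>R mat 1"
    and harm: "inf_laplacian u x = 0"
  shows "partial_deriv i u x \<bullet> partial_deriv j u x = (if i = j then r else 0)"
    and "(\<Sum>j\<in>UNIV. partial_deriv j u x \<bullet> partial_deriv k (partial_deriv j u) x) = 0"
    and "r \<noteq> 0 \<Longrightarrow> perp (grad u x) *v (\<Sum>i\<in>UNIV. partial_deriv i (partial_deriv i u) x) = 0"
proof -
  let ?a = "\<lambda>i. partial_deriv i u x"
  let ?t = "\<lambda>i. \<Sum>j\<in>UNIV. ?a j \<bullet> partial_deriv i (partial_deriv j u) x"
  let ?N = "perp (grad u x) *v (\<Sum>i\<in>UNIV. partial_deriv i (partial_deriv i u) x)"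
  have inner: "?a i \<bullet> ?a j = (if i = j then r else 0)" for i j
  proof -
    have "(transpose (grad u x) ** grad u x) $ i $ j = ?a i \<bullet> ?a j"
      by (simp add: matrix_matrix_mult_def transpose_def grad_nth inner_vec_def)
    then show ?thesis by (auto simp: conf mat_def)
  qed
  then show "?a i \<bullet> ?a j = (if i = j then r else 0)" .
  have eq: "0 = (\<Sum>i\<in>UNIV. ?t i *\<^sub>R ?a i) + (norm (grad u x))\<^sup>2 *\<^sub>R ?N"
    using inf_laplacian_vector_form[OF S] harm by simp
  have t0: "?t k = 0" for k
  proof (cases "r = 0")
    case True
    then have "?a j = 0" for j using inner[of j j] by simp
    then show ?thesis by simp
  next
    case False
    have "?a k \<bullet> ?N = 0"
      using perp_mult_vec(1)[of "grad u x"] transpose_grad_mult by (metis zero_index)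
    then have "0 = ?a k \<bullet> (\<Sum>i\<in>UNIV. ?t i *\<^sub>R ?a i)"
      using arg_cong[OF eq, of "\<lambda>v. ?a k \<bullet> v"] by (simp add: inner_add_right)
    also have "\<dots> = (\<Sum>i\<in>UNIV. if k = i then ?t i * r else 0)"
      unfolding inner_sum_right by (intro sum.cong) (auto simp: inner)
    also have "\<dots> = ?t k * r" by simp
    finally show ?thesis using False by simp
  qed
  show "?t k = 0" by (rule t0)
  show "?N = 0" if "r \<noteq> 0"
  proof -
    have "(norm (grad u x))\<^sup>2 = real CARD('n) * r"
      by (simp add: norm_grad inner)
    then show ?thesis using eq t0 that by simp
  qed
qed

lemma has_derivative_inner_partials:
  fixes u :: "real^'n::finite \<Rightarrow> real^'m::finite"
  assumes "Ck_on 2 u S" "x \<in> S"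
  shows "((\<lambda>y. partial_deriv i u y \<bullet> partial_deriv j u y) has_derivative
    (\<lambda>h. \<Sum>k\<in>UNIV. h $ k * (partial_deriv i u x \<bullet> partial_deriv k (partial_deriv j u) x
       + partial_deriv k (partial_deriv i u) x \<bullet> partial_deriv j u x))) (at x)"
  using has_derivative_inner[OF has_derivative_partial_deriv[OF Ck_on_2D(2)[OF assms]]
      has_derivative_partial_deriv[OF Ck_on_2D(2)[OF assms]], of i j]
  by (simp add: inner_sum_left inner_sum_right sum.distrib[symmetric] distrib_left)

text \<open>
  The tangential coefficients are half the partial derivatives of
  \<open>|Du|^2\<close>, and \<open>|Du|^2\<close> is the conformal factor \<open>r\<close> times the dimension.
\<close>

lemma conformal_factor_constant:
  fixes u :: "real^'n::finite \<Rightarrow> real^'m::finite"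
  assumes "open S" "connected S" "Ck_on 2 u S"
    and conf: "\<And>x. x \<in> S \<Longrightarrow> transpose (grad u x) ** grad u x = r x *\<^sub>R mat 1"
    and harm: "\<And>x. x \<in> S \<Longrightarrow> inf_laplacian u x = 0"
    and "x \<in> S" "y \<in> S"
  shows "r x = r y"
proof -
  note P = conformal_inf_harmonic_pointwise[OF assms(1,3) _ conf harm]
  let ?E = "\<lambda>y. \<Sum>j\<in>UNIV. partial_deriv j u y \<bullet> partial_deriv j u y"
  have "(?E has_derivative (\<lambda>h. 0)) (at z)" if z: "z \<in> S" for z
  proof -
    have "(\<Sum>j\<in>UNIV. \<Sum>k\<in>UNIV. h $ k * (partial_deriv j u z \<bullet> partial_deriv k (partial_deriv j u) z
       + partial_deriv k (partial_deriv j u) z \<bullet> partial_deriv j u z)) = 0" for h :: "real^'n"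
    proof -
      have "(\<Sum>j\<in>UNIV. \<Sum>k\<in>UNIV. h $ k * (partial_deriv j u z \<bullet> partial_deriv k (partial_deriv j u) z
         + partial_deriv k (partial_deriv j u) z \<bullet> partial_deriv j u z))
        = (\<Sum>k\<in>UNIV. 2 * h $ k * (\<Sum>j\<in>UNIV. partial_deriv j u z \<bullet> partial_deriv k (partial_deriv j u) z))"
        by (subst sum.swap) (simp add: inner_commute sum_distrib_left mult_ac)
      then show ?thesis by (simp add: P(2)[OF z z z])
    qed
    moreover have "(?E has_derivative (\<lambda>h. \<Sum>j\<in>UNIV. \<Sum>k\<in>UNIV.
        h $ k * (partial_deriv j u z \<bullet> partial_deriv k (partial_deriv j u) z
          + partial_deriv k (partial_deriv j u) z \<bullet> partial_deriv j u z))) (at z)"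
      by (intro has_derivative_sum has_derivative_inner_partials[OF assms(3) z])
    ultimately show ?thesis by (simp only:)
  qed
  from has_derivative_zero_unique_connected[OF assms(1,2) this assms(6,7)]
  have "?E x = ?E y" .
  then show ?thesis using assms(6,7) by (simp add: P(1))
qed

text \<open>
  If the conformal factor is zero, then \<open>Du\<close> vanishes identically. Otherwise the Leibniz rule for
  the constant \<open>D_i u \<bullet> D_k u\<close> and the symmetry of second derivatives give
  \<open>D_k u \<bullet> D_i (D_i u) = - D_i u \<bullet> D_k (D_i u)\<close>. Summed over \<open>i\<close>, the right-hand side is a
  tangential coefficient, which is zero. So the Laplacian is purely normal, and its normal
  projection vanishes.
\<close>

lemma conformal_inf_harmonic_imp_harmonic:
  fixes u :: "real^'n::finite \<Rightarrow> real^'m::finite"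
  assumes "open S" "Ck_on 2 u S"
    and conf: "\<And>x. x \<in> S \<Longrightarrow> transpose (grad u x) ** grad u x = c *\<^sub>R mat 1"
    and harm: "\<And>x. x \<in> S \<Longrightarrow> inf_laplacian u x = 0"
    and x: "x \<in> S"
  shows "(\<Sum>i\<in>UNIV. partial_deriv i (partial_deriv i u) x) = 0"
proof -
  note P = conformal_inf_harmonic_pointwise[OF assms(1,2) _ conf harm]
  let ?H = "\<lambda>i j. partial_deriv i (partial_deriv j u) x"
  show ?thesis
  proof (cases "c = 0")
    case True
    have "partial_deriv i u y = 0" if "y \<in> S" for i y
      using P(1)[OF that that that, of i i] True by simp
    then have "(partial_deriv i u has_derivative (\<lambda>h. 0)) (at x)" for i
      by (intro has_derivative_transform_within_open[OF has_derivative_const assms(1) x]) auto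
    from partial_deriv_eqI[OF this] show ?thesis by simp
  next
    case False
    have leibniz: "partial_deriv i u x \<bullet> ?H k j + ?H k i \<bullet> partial_deriv j u x = 0" for i j k
    proof -
      have "((\<lambda>y. partial_deriv i u y \<bullet> partial_deriv j u y) has_derivative (\<lambda>h. 0)) (at x)"
        by (rule has_derivative_transform_within_open[OF has_derivative_const[of "if i = j then c else 0"] assms(1) x])
          (simp add: P(1))
      \<comment> \<open>compare the two derivatives of \<open>D_i u \<bullet> D_j u\<close> in the direction of the \<open>k\<close>-th axis\<close>
      from has_derivative_unique[OF this has_derivative_inner_partials[OF assms(2) x]]
      have "0 = (\<Sum>l\<in>UNIV. (axis k 1 :: real^'n) $ l *\<^sub>R (partial_deriv i u x \<bullet> ?H l j + ?H l i \<bullet> partial_deriv j u x))"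
        by (simp only: real_scaleR_def) metis
      then show ?thesis by (simp only: sum_axis_scaleR)
    qed
    have "partial_deriv k u x \<bullet> (\<Sum>i\<in>UNIV. ?H i i) = 0" for k
    proof -
      have "partial_deriv k u x \<bullet> ?H i i = - (partial_deriv i u x \<bullet> ?H k i)" for i
        using leibniz[of i i k] mixed_partials_commute[OF assms(1,2) x, of i k]
        by (simp add: inner_commute)
      then have "partial_deriv k u x \<bullet> (\<Sum>i\<in>UNIV. ?H i i) = - (\<Sum>i\<in>UNIV. partial_deriv i u x \<bullet> ?H k i)"
        by (simp add: inner_sum_right sum_negf)
      then show ?thesis by (simp add: P(2)[OF x x x])
    qed
    then have "transpose (grad u x) *v (\<Sum>i\<in>UNIV. ?H i i) = 0"
      by (simp add: vec_eq_iff transpose_grad_mult del: transpose_matrix_vector)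
    from perp_mult_vec(2)[OF this] P(3)[OF x x x False] show ?thesis by simp
  qed
qed

section \<open>Conjugate pairs of constant length\<close>

text \<open>
  For fixed \<open>w\<close>, the Hermitian product \<open>g\<close> of \<open>\<phi> y\<close> with \<open>\<phi> w\<close> is holomorphic in \<open>y\<close>. By Cauchy-Schwarz
  its modulus is at most \<open>c^2\<close>, and this value is attained at \<open>y = w\<close>. The maximum modulus
  principle makes \<open>g\<close> constant, and then equality in Cauchy-Schwarz forces \<open>\<phi> z = \<phi> w\<close>.
\<close>

lemma holomorphic_constant_norm_imp_constant:
  fixes \<phi> :: "complex \<Rightarrow> complex^'m::finite"
  assumes S: "open S" "connected S"
    and hol: "\<And>\<beta>. (\<lambda>z. \<phi> z $ \<beta>) holomorphic_on S"
    and nrm: "\<And>z. z \<in> S \<Longrightarrow> norm (\<phi> z) = c"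
    and zw: "z \<in> S" "w \<in> S"
  shows "\<phi> z = \<phi> w"
proof -
  define g where "g y = (\<Sum>\<beta>\<in>UNIV. \<phi> y $ \<beta> * cnj (\<phi> w $ \<beta>))" for y
  have holg: "g holomorphic_on S"
    unfolding g_def by (intro holomorphic_intros hol)
  have Re_g: "Re (g y) = \<phi> y \<bullet> \<phi> w" for y
    by (simp add: g_def inner_vec_def inner_complex_def)
  have "cmod (g y) \<le> c * c" if "y \<in> S" for y
  proof -
    have "cmod (g y) \<le> (\<Sum>\<beta>\<in>UNIV. \<bar>cmod (\<phi> y $ \<beta>)\<bar> * \<bar>cmod (\<phi> w $ \<beta>)\<bar>)"
      unfolding g_def by (rule order_trans[OF norm_sum]) (simp add: norm_mult)
    also have "\<dots> \<le> norm (\<phi> y) * norm (\<phi> w)"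
      unfolding norm_vec_def by (rule L2_set_mult_ineq)
    finally show ?thesis using nrm that zw by simp
  qed
  moreover have "c * c \<le> cmod (g w)"
    using complex_Re_le_cmod[of "g w"] nrm[OF zw(2)]
    by (simp add: Re_g power2_norm_eq_inner[symmetric] power2_eq_square)
  ultimately have "g constant_on S"
    using maximum_modulus_principle[OF holg S S(1) subset_refl zw(2)] by (meson order_trans)
  then have "g z = g w"
    using zw by (metis constant_on_def)
  then have "\<phi> z \<bullet> \<phi> w = \<phi> w \<bullet> \<phi> w"
    by (metis Re_g)
  moreover have "\<phi> z \<bullet> \<phi> z = \<phi> w \<bullet> \<phi> w"
    using nrm zw by (simp add: power2_norm_eq_inner[symmetric])
  ultimately have "(\<phi> z - \<phi> w) \<bullet> (\<phi> z - \<phi> w) = 0"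
    by (simp add: inner_diff_left inner_diff_right inner_commute)
  then show ?thesis by simp
qed

text \<open>
  The two derivative hypotheses are the Cauchy-Riemann equations for \<open>a - \<i> b\<close>, with
  complex derivative \<open>p - \<i> q\<close>. The maps \<open>P\<close> and \<open>Q\<close> in the proof identify the complex plane
  with \<open>real^2\<close>.
\<close>

lemma conjugate_pair_constant:
  fixes a b :: "real^2 \<Rightarrow> real^'m::finite"
  assumes C: "open C" "connected C"
    and da: "\<And>x. x \<in> C \<Longrightarrow> (a has_derivative (\<lambda>h. h $ 1 *\<^sub>R p x + h $ 2 *\<^sub>R q x)) (at x)"
    and db: "\<And>x. x \<in> C \<Longrightarrow> (b has_derivative (\<lambda>h. h $ 1 *\<^sub>R q x - h $ 2 *\<^sub>R p x)) (at x)"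
    and nrm: "\<And>x. x \<in> C \<Longrightarrow> a x \<bullet> a x + b x \<bullet> b x = c"
    and xy: "x \<in> C" "y \<in> C"
  shows "a x = a y \<and> b x = b y"
proof -
  define P :: "complex \<Rightarrow> real^2" where "P z = (\<chi> i. if i = 1 then Re z else Im z)" for z
  define Q :: "real^2 \<Rightarrow> complex" where "Q v = Complex (v $ 1) (v $ 2)" for v
  have P12: "P z $ 1 = Re z" "P z $ 2 = Im z" for z
    by (simp_all add: P_def)
  have PQ: "P (Q v) = v" for v
    by (simp add: vec_eq_iff forall_2 P12 Q_def)
  have QP: "Q (P z) = z" for z
    by (simp add: Q_def P12)
  have bP: "bounded_linear P"
    unfolding linear_conv_bounded_linear[symmetric]
    by (rule linearI) (simp_all add: vec_eq_iff forall_2 P12)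
  have bQ: "bounded_linear Q"
    unfolding linear_conv_bounded_linear[symmetric]
    by (rule linearI) (simp_all add: Q_def complex_eq_iff)
  define S where "S = P -` C"
  have "open S"
    unfolding S_def by (intro continuous_open_vimage C linear_continuous_at bP)
  have "S = Q ` C"
    using PQ QP unfolding S_def by (auto simp: image_iff) metis
  then have "connected S"
    using C by (simp add: connected_continuous_image linear_continuous_on bQ)
  define \<phi> where "\<phi> z = (\<chi> \<beta>. complex_of_real (a (P z) $ \<beta>) - \<i> * complex_of_real (b (P z) $ \<beta>))" for z
  have dP: "(P has_derivative P) (at z)" for z
    using bP by (rule bounded_linear_imp_has_derivative)
  have "(\<lambda>z. \<phi> z $ \<beta>) holomorphic_on S" for \<beta>
  proof -
    have "((\<lambda>z. \<phi> z $ \<beta>) has_field_derivative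
        complex_of_real (p (P z) $ \<beta>) - \<i> * complex_of_real (q (P z) $ \<beta>)) (at z)"
      if "z \<in> S" for z
    proof -
      have PC: "P z \<in> C" using that by (simp add: S_def)
      note da' = has_derivative_compose[OF dP da[OF PC]]
      note db' = has_derivative_compose[OF dP db[OF PC]]
      note D = bounded_linear.has_derivative[OF bounded_linear_of_real
          bounded_linear.has_derivative[OF bounded_linear_vec_nth]]
      have "((\<lambda>z. \<phi> z $ \<beta>) has_derivative
          (\<lambda>h. complex_of_real ((P h $ 1 *\<^sub>R p (P z) + P h $ 2 *\<^sub>R q (P z)) $ \<beta>)
             - \<i> * complex_of_real ((P h $ 1 *\<^sub>R q (P z) - P h $ 2 *\<^sub>R p (P z)) $ \<beta>))) (at z)"
        unfolding \<phi>_def vec_lambda_beta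
        by (intro has_derivative_diff has_derivative_mult_right D da' db')
      then show ?thesis
        unfolding has_field_derivative_def
        by (rule has_derivative_eq_rhs) (auto simp: fun_eq_iff P12 complex_eq_iff algebra_simps)
    qed
    then show ?thesis
      by (auto simp: holomorphic_on_open[OF \<open>open S\<close>])
  qed
  moreover have "norm (\<phi> z) = sqrt c" if "z \<in> S" for z
  proof -
    have "(cmod (complex_of_real s - \<i> * complex_of_real t))\<^sup>2 = s * s + t * t" for s t
      by (subst cmod_power2) (simp add: power2_eq_square)
    then have "(\<Sum>\<beta>\<in>UNIV. (cmod (\<phi> z $ \<beta>))\<^sup>2) = a (P z) \<bullet> a (P z) + b (P z) \<bullet> b (P z)"
      by (simp add: \<phi>_def inner_vec_def sum.distrib)
    then show ?thesis
      using nrm[of "P z"] that by (simp add: norm_vec_def L2_set_def S_def)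
  qed
  moreover have "Q x \<in> S" "Q y \<in> S"
    using xy by (simp_all add: S_def PQ)
  ultimately have "\<phi> (Q x) = \<phi> (Q y)"
    using holomorphic_constant_norm_imp_constant[OF \<open>open S\<close> \<open>connected S\<close>] by blast
  then show ?thesis
    by (simp add: \<phi>_def PQ vec_eq_iff complex_eq_iff)
qed

section \<open>The image lies in a plane\<close>

text \<open>
  Here \<open>a = D_1 u\<close> and \<open>b = D_2 u\<close> form the conjugate pair: one Cauchy-Riemann equation is the
  symmetry of second derivatives, and the other is \<open>D_2 (D_2 u) = - D_1 (D_1 u)\<close>, which is
  harmonicity.
\<close>

lemma conformal_inf_harmonic_gradient_constant:
  fixes u :: "real^2 \<Rightarrow> real^'m::finite"
  assumes C: "open C" "connected C" and u: "Ck_on 2 u C"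
    and conf: "\<And>x. x \<in> C \<Longrightarrow> transpose (grad u x) ** grad u x = r x *\<^sub>R mat 1"
    and harm: "\<And>x. x \<in> C \<Longrightarrow> inf_laplacian u x = 0"
    and xy: "x \<in> C" "y \<in> C"
  shows "partial_deriv i u x = partial_deriv i u y"
proof -
  define c where "c = r x"
  have conf': "transpose (grad u z) ** grad u z = c *\<^sub>R mat 1" if "z \<in> C" for z
    using conformal_factor_constant[OF C u conf harm that xy(1)] conf[OF that] by (simp add: c_def)
  have D: "(partial_deriv j u has_derivative (\<lambda>h. h $ 1 *\<^sub>R partial_deriv 1 (partial_deriv j u) z
      + h $ 2 *\<^sub>R partial_deriv 2 (partial_deriv j u) z)) (at z)" if "z \<in> C" for z j
    using has_derivative_partial_deriv[OF Ck_on_2D(2)[OF u that]] by (simp add: sum_2)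
  have "partial_deriv 1 u x = partial_deriv 1 u y \<and> partial_deriv 2 u x = partial_deriv 2 u y"
  proof (rule conjugate_pair_constant[OF C _ _ _ xy])
    fix z assume z: "z \<in> C"
    show "(partial_deriv 1 u has_derivative (\<lambda>h. h $ 1 *\<^sub>R partial_deriv 1 (partial_deriv 1 u) z
      + h $ 2 *\<^sub>R partial_deriv 2 (partial_deriv 1 u) z)) (at z)"
      by (rule D[OF z])
    have "partial_deriv 2 (partial_deriv 2 u) z = - partial_deriv 1 (partial_deriv 1 u) z"
      using conformal_inf_harmonic_imp_harmonic[OF C(1) u conf' harm z]
      by (simp add: sum_2 eq_neg_iff_add_eq_0 add.commute)
    then show "(partial_deriv 2 u has_derivative (\<lambda>h. h $ 1 *\<^sub>R partial_deriv 2 (partial_deriv 1 u) z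
      - h $ 2 *\<^sub>R partial_deriv 1 (partial_deriv 1 u) z)) (at z)"
      using D[OF z, of 2] mixed_partials_commute[OF C(1) u z, of 1 2] by simp
    show "partial_deriv 1 u z \<bullet> partial_deriv 1 u z + partial_deriv 2 u z \<bullet> partial_deriv 2 u z = 2 * c"
      using conformal_inf_harmonic_pointwise(1)[OF C(1) u z conf'[OF z] harm[OF z]] by simp
  qed
  then show ?thesis using exhaust_2[of i] by auto
qed

text \<open>
  A normal vector \<open>n\<close> exists since the two partial derivatives span at most a plane. Fixing
  \<open>n\<close> first, rather than taking the affine hull of the image, gives a set of dimension exactly two
  even when \<open>u\<close> degenerates to a constant.
\<close>

lemma image_subset_affine_plane:
  fixes u :: "real^2 \<Rightarrow> real^3"
  assumes C: "open C" "connected C" and u: "\<And>x. x \<in> C \<Longrightarrow> u differentiable (at x)"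
    and const: "\<And>x y i. x \<in> C \<Longrightarrow> y \<in> C \<Longrightarrow> partial_deriv i u x = partial_deriv i u y"
  shows "\<exists>P. affine_plane P \<and> u ` C \<subseteq> P"
proof -
  \<comment> \<open>if \<open>C\<close> is empty, then \<open>p\<close> is arbitrary and any plane will do\<close>
  define p where "p = (SOME x. x \<in> C)"
  have p: "p \<in> C" if "x \<in> C" for x
    unfolding p_def using that by (rule someI)
  let ?A = "{partial_deriv 1 u p, partial_deriv 2 u p}"
  have "dim ?A \<le> card ?A" by (rule dim_le_card') simp
  also have "\<dots> \<le> 2" by (simp add: card_insert_if)
  finally have "dim ?A < DIM(real^3)" by simp
  then obtain n where n: "n \<noteq> 0" "\<And>y. y \<in> span ?A \<Longrightarrow> orthogonal n y"
    using orthogonal_to_subspace_exists by metis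
  have n12: "n \<bullet> partial_deriv i u p = 0" for i
    using n(2) exhaust_2[of i] by (auto simp: orthogonal_def span_base)
  have "((\<lambda>y. n \<bullet> u y) has_derivative (\<lambda>h. 0)) (at x)" if x: "x \<in> C" for x
  proof -
    have "n \<bullet> (\<Sum>i\<in>UNIV. h $ i *\<^sub>R partial_deriv i u x) = 0" for h :: "real^2"
      unfolding const[OF x p[OF x]] by (simp add: inner_sum_right n12)
    then show ?thesis
      using has_derivative_inner_right[OF has_derivative_partial_deriv[OF u[OF x]], of n] by simp
  qed
  from has_derivative_zero_unique_connected[OF C this]
  have "u ` C \<subseteq> {x. n \<bullet> x = n \<bullet> u p}"
    using p by blast
  moreover have "affine_plane {x. n \<bullet> x = n \<bullet> u p}"
    using n(1) by (simp add: affine_plane_def affine_hyperplane aff_dim_hyperplane)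
  ultimately show ?thesis by blast
qed

lemma Ck_on_subset: "Ck_on k f S \<Longrightarrow> T \<subseteq> S \<Longrightarrow> Ck_on k f T"
  by (induction k arbitrary: f) (auto intro: continuous_on_subset)

theorem corollary3p5:
  fixes \<Omega> :: "(real^2) set" and u :: "real^2 \<Rightarrow> real^3"
  assumes "open \<Omega>"
    and "Ck_on 2 u \<Omega>"
    and "conformal_on \<Omega> u"
    and "inf_harmonic_on \<Omega> u"
  shows "(connected \<Omega> \<longrightarrow> (\<exists>P. affine_plane P \<and> u ` \<Omega> \<subseteq> P))
       \<and> (\<forall>C\<in>components \<Omega>. \<exists>P. affine_plane P \<and> u ` C \<subseteq> P)"
proof -
  obtain f where f: "\<And>x. x \<in> \<Omega> \<Longrightarrow> transpose (grad u x) ** grad u x = (f x)\<^sup>2 *\<^sub>R mat 1"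
    using assms(3) unfolding conformal_on_def by blast
  have plane: "\<exists>P. affine_plane P \<and> u ` C \<subseteq> P" if C: "open C" "connected C" "C \<subseteq> \<Omega>" for C
  proof (rule image_subset_affine_plane[OF C(1,2)])
    have u: "Ck_on 2 u C" using Ck_on_subset assms(2) C(3) by blast
    show "u differentiable (at x)" if "x \<in> C" for x
      using Ck_on_2D(1)[OF u that] .
    show "partial_deriv i u x = partial_deriv i u y" if "x \<in> C" "y \<in> C" for x y i
      using f assms(4) C(3)
      by (intro conformal_inf_harmonic_gradient_constant[OF C(1,2) u _ _ that, of "\<lambda>x. (f x)\<^sup>2"])
        (auto simp: inf_harmonic_on_def)
  qed
  show ?thesis
  proof (intro conjI impI ballI)
    show "\<exists>P. affine_plane P \<and> u ` \<Omega> \<subseteq> P" if "connected \<Omega>"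
      using plane[OF assms(1) that] by simp
    show "\<exists>P. affine_plane P \<and> u ` C \<subseteq> P" if "C \<in> components \<Omega>" for C
      using plane[OF open_components[OF assms(1) that] in_components_connected[OF that]
          in_components_subset[OF that]] .
  qed
qed

end
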